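(* Let $\{X_t\}_{t\in\mathbb Z}$ be a strictly stationary sequence of real random variables with $\operatorname E X_0=0$ and $\operatorname E X_0^2<\infty$, with autocovariances $\gamma(h)=\operatorname{Cov}(X_h,X_0)$. Suppose that $\sum_{h=1}^\infty h^r|\gamma(h)|<\infty$ for some $r\ge0$, and let $m=m_n$ be a sequence of positive integers with $m\to\infty$ and $m=o(n)$ as $n\to\infty$. Then, as $n\to\infty$, $$\operatorname E Q_n-f(0)=\begin{cases}o(1)&\text{if } r=0,\\ O((m/n)^r)&\text{if } 0<r\le1,\\ O\bigl(\max\{n^{-1},(m/n)^{\min\{2,r\}}\}\bigr)&\text{if } r>1.\end{cases}$$
   Context: The spectral density is $f(\omega)=\frac1{2\pi}\sum_{h=-\infty}^\infty\gamma(h)e^{-ih\omega}$, $\omega\in[-\pi,\pi]$. The Fourier frequencies are $\omega_j=2\pi j/n$, the periodogram of $X_1,\ldots,X_n$ is $I_n(\omega_j)=\bigl|\frac1{\sqrt{2\pi n}}\sum_{t=1}^nX_te^{-it\omega_j}\bigr|^2$, and $Q_n=\frac1m\sum_{j=1}^mI_n(\omega_j)$. *)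

theory Defs
  imports "HOL-Probability.Probability" "HOL-Library.Landau_Symbols"
begin

text \<open>Strict stationarity: all finite-dimensional distributions are invariant under time shifts.
  The joint law of \<open>(X t)\<close>, \<open>t \<in> J\<close>, is a measure on the product space indexed by the finite set \<open>J\<close>.\<close>

definition strictly_stationary :: "'a measure \<Rightarrow> (int \<Rightarrow> 'a \<Rightarrow> real) \<Rightarrow> bool" where
  "strictly_stationary M X \<longleftrightarrow>
     (\<forall>t. X t \<in> borel_measurable M) \<and>
     (\<forall>J h. finite J \<longrightarrow>
        distr M (\<Pi>\<^sub>M t\<in>J. borel) (\<lambda>x. \<lambda>t\<in>J. X (t + h) x) =
        distr M (\<Pi>\<^sub>M t\<in>J. borel) (\<lambda>x. \<lambda>t\<in>J. X t x))"

definition covariance :: "'a measure \<Rightarrow> ('a \<Rightarrow> real) \<Rightarrow> ('a \<Rightarrow> real) \<Rightarrow> real" where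
  "covariance M Y Z =
     (\<integral>x. (Y x - (\<integral>y. Y y \<partial>M)) * (Z x - (\<integral>y. Z y \<partial>M)) \<partial>M)"

definition autocov :: "'a measure \<Rightarrow> (int \<Rightarrow> 'a \<Rightarrow> real) \<Rightarrow> int \<Rightarrow> real" where
  "autocov M X h = covariance M (X h) (X 0)"

text \<open>Complex-valued, as the defining series is; it is the junk value 0 if the
  autocovariances are not absolutely summable.\<close>

definition spectral_density :: "'a measure \<Rightarrow> (int \<Rightarrow> 'a \<Rightarrow> real) \<Rightarrow> real \<Rightarrow> complex" where
  "spectral_density M X \<omega> =
     complex_of_real (1 / (2 * pi)) *
     (\<Sum>\<^sub>\<infinity>h\<in>UNIV. complex_of_real (autocov M X h) * exp (- \<i> * of_int h * of_real \<omega>))"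

definition fourier_freq :: "nat \<Rightarrow> nat \<Rightarrow> real" where
  "fourier_freq n j = 2 * pi * real j / real n"

definition periodogram :: "(int \<Rightarrow> 'a \<Rightarrow> real) \<Rightarrow> nat \<Rightarrow> real \<Rightarrow> 'a \<Rightarrow> real" where
  "periodogram X n \<omega> x =
     (cmod (complex_of_real (1 / sqrt (2 * pi * real n)) *
        (\<Sum>t=1..n. complex_of_real (X (int t) x) * exp (- \<i> * of_nat t * of_real \<omega>))))\<^sup>2"

definition avg_periodogram :: "(int \<Rightarrow> 'a \<Rightarrow> real) \<Rightarrow> nat \<Rightarrow> nat \<Rightarrow> 'a \<Rightarrow> real" where
  "avg_periodogram X m n x =
     1 / real m * (\<Sum>j=1..m. periodogram X n (fourier_freq n j) x)"

end

theory Submission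
  imports Defs
begin

text \<open>Expanding the periodogram and taking expectations gives, with
  \<open>w\<^sub>n(h) = (1 - h/n)\<^sup>+ \<cdot> 1/m \<Sum>\<^sub>j cos (h \<omega>\<^sub>j)\<close>, the bias
  \<open>1/\<pi> \<Sum>\<^sub>h \<gamma>(h) (w\<^sub>n(h) - 1)\<close>, summed over \<open>h \<ge> 1\<close>. Since \<open>1 - cos x \<le> min (2, x\<^sup>2/2)\<close>,
  \<open>|w\<^sub>n(h) - 1| \<le> min (1, h/n) + 2 \<pi>\<^sup>2 min (1, (mh/n)\<^sup>2)\<close>. Interpolating both minima by powers of
  \<open>h\<close> gives the two rates, and dominated convergence gives the case \<open>r = 0\<close>.\<close>

section \<open>Stationarity, second moments and autocovariances\<close>

lemma strictly_stationary_measurable: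
  "strictly_stationary M X \<Longrightarrow> X t \<in> borel_measurable M"
  by (simp add: strictly_stationary_def)

text \<open>The law of a pair is the image of the law on the index set \<open>{s, t}\<close> under
  evaluation at \<open>s\<close> and \<open>t\<close>. This covers \<open>s = t\<close> too, where
  the index set is a singleton.\<close>

lemma strictly_stationary_pair_distr:
  assumes "strictly_stationary M X"
  shows "distr M (borel \<Otimes>\<^sub>M borel) (\<lambda>x. (X (s + h) x, X (t + h) x)) =
         distr M (borel \<Otimes>\<^sub>M borel) (\<lambda>x. (X s x, X t x))"
proof -
  let ?P = "\<Pi>\<^sub>M u\<in>{s, t}. (borel :: real measure)"
  let ?e = "\<lambda>w :: int \<Rightarrow> real. (w s, w t)"
  have e: "?e \<in> ?P \<rightarrow>\<^sub>M borel \<Otimes>\<^sub>M borel"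
    by (intro measurable_Pair measurable_component_singleton) simp_all
  have r: "(\<lambda>x. \<lambda>u\<in>{s, t}. X (u + k) x) \<in> M \<rightarrow>\<^sub>M ?P" for k
    by (intro measurable_restrict strictly_stationary_measurable[OF assms])
  have shift: "distr M (borel \<Otimes>\<^sub>M borel) (\<lambda>x. (X (s + k) x, X (t + k) x)) =
      distr (distr M ?P (\<lambda>x. \<lambda>u\<in>{s, t}. X (u + k) x)) (borel \<Otimes>\<^sub>M borel) ?e" for k
    unfolding distr_distr[OF e r] comp_def by simp
  have "distr M ?P (\<lambda>x. \<lambda>u\<in>{s, t}. X (u + h) x) = distr M ?P (\<lambda>x. \<lambda>u\<in>{s, t}. X u x)"
    using conjunct2[OF assms[unfolded strictly_stationary_def], rule_format, of "{s, t}" h] by simp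
  then show ?thesis
    using shift[of h] shift[of 0] by simp
qed

text \<open>Both sides integrate \<open>f\<close> against the same pair law. Applied to one
  coordinate, its square, or the product of both, this carries the moment assumptions from time 0 to
  all times and makes product moments depend on the lag only.\<close>

lemma strictly_stationary_pair_integral:
  fixes f :: "real \<times> real \<Rightarrow> real"
  assumes "strictly_stationary M X" and "f \<in> borel_measurable (borel \<Otimes>\<^sub>M borel)"
  shows "integrable M (\<lambda>x. f (X (s + h) x, X (t + h) x)) \<longleftrightarrow>
           integrable M (\<lambda>x. f (X s x, X t x))"
    and "(\<integral>x. f (X (s + h) x, X (t + h) x) \<partial>M) = (\<integral>x. f (X s x, X t x) \<partial>M)"
proof -
  note [measurable] = strictly_stationary_measurable[OF assms(1)] assms(2)
  note eq = strictly_stationary_pair_distr[OF assms(1), of s h t]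
  have m: "(\<lambda>x. (X u x, X v x)) \<in> M \<rightarrow>\<^sub>M borel \<Otimes>\<^sub>M borel" for u v
    by measurable
  show "integrable M (\<lambda>x. f (X (s + h) x, X (t + h) x)) \<longleftrightarrow>
           integrable M (\<lambda>x. f (X s x, X t x))"
    using integrable_distr_eq[OF m assms(2), of "s + h" "t + h"]
      integrable_distr_eq[OF m assms(2), of s t] eq by simp
  show "(\<integral>x. f (X (s + h) x, X (t + h) x) \<partial>M) = (\<integral>x. f (X s x, X t x) \<partial>M)"
    using integral_distr[OF m assms(2), of "s + h" "t + h"]
      integral_distr[OF m assms(2), of s t] eq by simp
qed

locale centred_stationary = prob_space +
  fixes X :: "int \<Rightarrow> 'a \<Rightarrow> real"
  assumes stationary: "strictly_stationary M X"
    and square_integrable_0: "integrable M (\<lambda>x. (X 0 x)\<^sup>2)"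
    and mean_0: "(\<integral>x. X 0 x \<partial>M) = 0"
begin

lemma random_variable_X [measurable]: "random_variable borel (X t)"
  by (rule strictly_stationary_measurable[OF stationary])

lemma square_integrable: "integrable M (\<lambda>x. (X t x)\<^sup>2)"
  using strictly_stationary_pair_integral(1)[OF stationary, of "\<lambda>p. (fst p)\<^sup>2" 0 t 0]
    square_integrable_0 by simp

lemma mean: "(\<integral>x. X t x \<partial>M) = 0"
  using strictly_stationary_pair_integral(2)[OF stationary, of "fst" 0 t 0] mean_0 by simp

lemma integrable_X_mult: "integrable M (\<lambda>x. X s x * X t x)"
proof (rule Bochner_Integration.integrable_bound)
  show "integrable M (\<lambda>x. (X s x)\<^sup>2 + (X t x)\<^sup>2)"
    by (intro Bochner_Integration.integrable_add square_integrable)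
  have "\<bar>a * b\<bar> \<le> a\<^sup>2 + b\<^sup>2" for a b :: real
  proof -
    have "2 * (\<bar>a\<bar> * \<bar>b\<bar>) \<le> a\<^sup>2 + b\<^sup>2"
      using sum_squares_bound[of "\<bar>a\<bar>" "\<bar>b\<bar>"] by (simp add: mult.assoc)
    moreover have "0 \<le> \<bar>a\<bar> * \<bar>b\<bar>"
      by simp
    ultimately show ?thesis
      unfolding abs_mult by linarith
  qed
  then show "AE x in M. norm (X s x * X t x) \<le> norm ((X s x)\<^sup>2 + (X t x)\<^sup>2)"
    by simp
qed measurable

text \<open>Shifting both times back by \<open>t\<close> leaves the product moment at times
  \<open>s - t\<close> and 0, which is a covariance because the means vanish.\<close>

lemma autocov_eq: "(\<integral>x. X s x * X t x \<partial>M) = autocov M X (s - t)"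
proof -
  have "(\<integral>x. X s x * X t x \<partial>M) = (\<integral>x. X (s - t) x * X 0 x \<partial>M)"
    using strictly_stationary_pair_integral(2)[OF stationary,
        of "\<lambda>p. fst p * snd p" "s - t" t 0] by simp
  then show ?thesis
    by (simp add: autocov_def covariance_def mean)
qed

lemma autocov_minus: "autocov M X (- h) = autocov M X h"
  using autocov_eq[of 0 h] autocov_eq[of h 0] by (simp add: mult.commute)

end

section \<open>The expected averaged periodogram\<close>

lemma periodogram_eq:
  "periodogram X n \<omega> x = 1 / (2 * pi * real n) *
     (\<Sum>s=1..n. \<Sum>t=1..n. X (int s) x * X (int t) x * cos ((real s - real t) * \<omega>))"
proof -
  let ?S = "\<Sum>t=1..n. complex_of_real (X (int t) x) * exp (- \<i> * of_nat t * of_real \<omega>)"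
  have e: "exp (- \<i> * of_nat t * of_real \<omega>) = cis (- (real t * \<omega>))" for t
    unfolding cis_conv_exp by (rule arg_cong[where f = exp]) simp
  \<comment> \<open>The squared modulus is the squared cosine sum plus the squared sine sum; the
    formula for the cosine of a difference merges them into one double sum.\<close>
  have "(cmod ?S)\<^sup>2 =
      (\<Sum>t=1..n. X (int t) x * cos (real t * \<omega>))\<^sup>2 + (\<Sum>t=1..n. X (int t) x * sin (real t * \<omega>))\<^sup>2"
    unfolding e cmod_power2 Re_sum Im_sum by (simp add: sum_negf)
  also have "\<dots> = (\<Sum>s=1..n. \<Sum>t=1..n. X (int s) x * X (int t) x * cos ((real s - real t) * \<omega>))"
    unfolding power2_eq_square sum_product sum.distrib[symmetric]
    by (intro sum.cong refl) (simp add: cos_diff left_diff_distrib algebra_simps)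
  finally have "(cmod ?S)\<^sup>2 = \<dots>" .
  moreover have "(cmod (complex_of_real (1 / sqrt (2 * pi * real n))))\<^sup>2 = 1 / (2 * pi * real n)"
    by (simp only: norm_of_real) (simp add: power_divide real_sqrt_abs)
  ultimately show ?thesis
    by (simp only: periodogram_def norm_mult power_mult_distrib)
qed

text \<open>Induction on \<open>n\<close>: enlarging the square adds a last row and a last column,
  equal by evenness, and the corner \<open>g 0\<close>. Lag \<open>k\<close> with
  \<open>1 \<le> k < n\<close> occurs \<open>n - k\<close> times with each sign; the summand at
  \<open>h = n - 1\<close> is zero.\<close>

lemma double_sum_even_diff:
  fixes g :: "int \<Rightarrow> real"
  assumes "\<And>k. g (- k) = g k"
  shows "(\<Sum>s=1..n. \<Sum>t=1..n. g (int s - int t)) =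
         real n * g 0 + 2 * (\<Sum>h<n. (real n - real (Suc h)) * g (int (Suc h)))"
proof (induction n)
  case (Suc n)
  have flip: "g (int t - int (Suc n)) = g (int (Suc n) - int t)" for t
    using assms[of "int (Suc n) - int t"] by simp
  \<comment> \<open>Reindexing by \<open>h = n - t\<close> works because
    \<open>Suc n - t = Suc (n - t)\<close> for \<open>t \<le> n\<close>.\<close>
  have edge: "(\<Sum>t=1..n. g (int (Suc n) - int t)) = (\<Sum>h<n. g (int (Suc h)))"
    by (rule sum.reindex_bij_witness[of _ "\<lambda>h. n - h" "\<lambda>t. n - t"])
      (auto simp: of_nat_diff algebra_simps)
  have col: "(\<Sum>s=1..n. g (int s - int (Suc n))) = (\<Sum>h<n. g (int (Suc h)))"
    unfolding flip by (rule edge)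
  have snoc: "(\<Sum>i=1..Suc n. f i) = (\<Sum>i=1..n. f i) + f (Suc n)" for f :: "nat \<Rightarrow> real"
    by simp
  have "(\<Sum>s=1..Suc n. \<Sum>t=1..Suc n. g (int s - int t)) =
      (\<Sum>s=1..n. \<Sum>t=1..n. g (int s - int t)) + 2 * (\<Sum>h<n. g (int (Suc h))) + g 0"
    unfolding snoc sum.distrib edge col by simp
  then show ?case
    by (simp only: Suc) (simp add: algebra_simps sum.distrib sum_distrib_left sum_subtractf)
qed simp

text \<open>The positive part extends the triangular weight by zero to lags \<open>h \<ge> n\<close>, so that
  \<open>avg_weight_dist_1\<close> covers the truncated tail of the spectral density too.\<close>

definition avg_weight :: "nat \<Rightarrow> nat \<Rightarrow> nat \<Rightarrow> real" where
  "avg_weight m n h = max 0 (1 - real h / real n) *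
     (1 / real m * (\<Sum>j=1..m. cos (real h * fourier_freq n j)))"

text \<open>At a fixed frequency, counting pairs by lag produces the triangular factor
  \<open>1 - k/n\<close> times a cosine. Only the cosine depends on the frequency, so averaging over
  \<open>j\<close> turns the product into \<open>avg_weight\<close>.\<close>

lemma (in centred_stationary) expectation_avg_periodogram:
  assumes "1 \<le> n" "1 \<le> m"
  shows "(\<integral>x. avg_periodogram X m n x \<partial>M) = 1 / (2 * pi) *
     (autocov M X 0 + 2 * (\<Sum>h<n. autocov M X (int (Suc h)) * avg_weight m n (Suc h)))"
proof -
  have int: "integrable M (\<lambda>x. periodogram X n \<omega> x)" for \<omega>
    unfolding periodogram_eq
    by (intro Bochner_Integration.integrable_mult_right Bochner_Integration.integrable_sum
        Bochner_Integration.integrable_mult_left integrable_X_mult)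
  have per: "(\<integral>x. periodogram X n \<omega> x \<partial>M) = 1 / (2 * pi) * (autocov M X 0 +
      2 * (\<Sum>h<n. autocov M X (int (Suc h)) * (max 0 (1 - real (Suc h) / real n) * cos (real (Suc h) * \<omega>))))" for \<omega>
  proof -
    \<comment> \<open>A product of two even functions of \<open>k\<close>, so the double sum
      collapses to a sum over lags.\<close>
    let ?g = "\<lambda>k. autocov M X k * cos (of_int k * \<omega>)"
    have "(\<integral>x. periodogram X n \<omega> x \<partial>M) =
        1 / (2 * pi * real n) * (\<Sum>s=1..n. \<Sum>t=1..n. ?g (int s - int t))"
      unfolding periodogram_eq by (simp add: integrable_X_mult autocov_eq)
    also have "(\<Sum>s=1..n. \<Sum>t=1..n. ?g (int s - int t)) =
        real n * ?g 0 + 2 * (\<Sum>h<n. (real n - real (Suc h)) * ?g (int (Suc h)))"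
      by (rule double_sum_even_diff) (simp add: autocov_minus)
    also have "(\<Sum>h<n. (real n - real (Suc h)) * ?g (int (Suc h))) =
        real n * (\<Sum>h<n. autocov M X (int (Suc h)) * (max 0 (1 - real (Suc h) / real n) * cos (real (Suc h) * \<omega>)))"
      unfolding sum_distrib_left
    proof (rule sum.cong)
      fix h assume "h \<in> {..<n}"
      \<comment> \<open>The lag \<open>Suc h\<close> is at most \<open>n\<close>, so the positive
        part changes nothing here.\<close>
      then have "real n * max 0 (1 - real (Suc h) / real n) = real n - real (Suc h)"
        by (auto simp: max_def field_simps)
      then show "(real n - real (Suc h)) * ?g (int (Suc h)) = real n *
          (autocov M X (int (Suc h)) * (max 0 (1 - real (Suc h) / real n) * cos (real (Suc h) * \<omega>)))"
        by (metis (no_types, opaque_lifting) mult.assoc mult.left_commute of_int_of_nat_eq)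
    qed simp
    also have "1 / (2 * pi * real n) * (real n * u + 2 * (real n * v)) = 1 / (2 * pi) * (u + 2 * v)" for u v
      using assms by (simp add: field_simps)
    finally show ?thesis
      by simp
  qed
  have "(\<integral>x. avg_periodogram X m n x \<partial>M) =
      1 / real m * (\<Sum>j=1..m. \<integral>x. periodogram X n (fourier_freq n j) x \<partial>M)"
    unfolding avg_periodogram_def by (simp add: int)
  also have "\<dots> = 1 / (2 * pi) * (1 / real m * (\<Sum>j=1..m. autocov M X 0) + 2 * (1 / real m *
      (\<Sum>j=1..m. \<Sum>h<n. autocov M X (int (Suc h)) *
        (max 0 (1 - real (Suc h) / real n) * cos (real (Suc h) * fourier_freq n j)))))"
    unfolding per sum_distrib_left[symmetric] sum.distrib by (simp add: algebra_simps)
  also have "1 / real m * (\<Sum>j=1..m. autocov M X 0) = autocov M X 0"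
    using assms by simp
  also have "1 / real m * (\<Sum>j=1..m. \<Sum>h<n. autocov M X (int (Suc h)) *
        (max 0 (1 - real (Suc h) / real n) * cos (real (Suc h) * fourier_freq n j))) =
      (\<Sum>h<n. autocov M X (int (Suc h)) * avg_weight m n (Suc h))"
    by (subst sum.swap) (simp add: avg_weight_def sum_distrib_left mult_ac)
  finally show ?thesis .
qed

section \<open>The bias as a weighted series of autocovariances\<close>

text \<open>At frequency 0 all exponentials are 1. Absolute summability turns the ordered series
  over positive lags into an unordered sum, evenness reflects it to the negative lags, and the
  integers split into \<open>{0}\<close>, \<open>{1..}\<close> and \<open>{..-1}\<close>.\<close>

lemma (in centred_stationary) spectral_density_0:
  assumes "summable (\<lambda>h. \<bar>autocov M X (int (Suc h))\<bar>)"
  shows "spectral_density M X 0 = complex_of_real (1 / (2 * pi) *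
     (autocov M X 0 + 2 * (\<Sum>h. autocov M X (int (Suc h)))))"
proof -
  let ?a = "autocov M X" and ?S = "\<Sum>h. autocov M X (int (Suc h))"
  have nat: "((\<lambda>h. ?a (int (Suc h))) has_sum ?S) UNIV"
    using norm_summable_imp_has_sum[of "\<lambda>h. ?a (int (Suc h))"] assms
    by (simp add: summable_rabs_cancel summable_sums)
  have pos: "(?a has_sum ?S) {1..}"
    using nat by (subst has_sum_reindex_bij_witness[of _ "\<lambda>h. int (Suc h)" "\<lambda>k. nat k - 1" UNIV "\<lambda>h. ?a (int (Suc h))" ?a])
      (auto simp: Suc_diff_Suc)
  have neg: "(?a has_sum ?S) {..-1}"
    using pos by (subst has_sum_reindex_bij_witness[of _ uminus uminus "{1..}" ?a ?a])
      (auto simp: autocov_minus)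
  have "(?a has_sum (?a 0 + (?S + ?S))) ({0} \<union> ({1..} \<union> {..-1}))"
    by (intro has_sum_Un_disjoint pos neg) (auto simp: has_sum_finite_iff)
  moreover have "{0} \<union> ({1..} \<union> {..-1}) = (UNIV :: int set)"
    by auto
  ultimately have "((\<lambda>h. complex_of_real (?a h)) has_sum complex_of_real (?a 0 + 2 * ?S)) UNIV"
    by (simp only: has_sum_of_real_iff) simp
  then have "(\<Sum>\<^sub>\<infinity>h. complex_of_real (?a h)) = complex_of_real (?a 0 + 2 * ?S)"
    by (rule infsumI)
  then show ?thesis
    by (simp add: spectral_density_def)
qed

text \<open>The weights vanish from lag \<open>n\<close> on, so the finite sum in the expectation is
  a full series and can be subtracted termwise. The lag-0 terms cancel, and the factor 2 turns
  \<open>1 / (2 * pi)\<close> into \<open>1 / pi\<close>.\<close>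

lemma (in centred_stationary) bias_eq:
  assumes "1 \<le> n" "1 \<le> m" and sum: "summable (\<lambda>h. \<bar>autocov M X (int (Suc h))\<bar>)"
  shows "complex_of_real (\<integral>x. avg_periodogram X m n x \<partial>M) - spectral_density M X 0 =
     complex_of_real (1 / pi * (\<Sum>h. autocov M X (int (Suc h)) * (avg_weight m n (Suc h) - 1)))"
proof -
  let ?a = "\<lambda>h. autocov M X (int (Suc h))" and ?w = "\<lambda>h. avg_weight m n (Suc h)"
  have zero: "?w h = 0" if "n \<le> h" for h
    using that assms by (auto simp: avg_weight_def max_def field_simps)
  have "(\<lambda>h. ?a h * ?w h) sums (\<Sum>h<n. ?a h * ?w h)"
    by (rule sums_finite) (auto simp: zero)
  moreover have "?a sums (\<Sum>h. ?a h)"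
    using sum by (intro summable_sums) (rule summable_rabs_cancel)
  ultimately have "(\<lambda>h. ?a h * ?w h - ?a h) sums ((\<Sum>h<n. ?a h * ?w h) - (\<Sum>h. ?a h))"
    by (rule sums_diff)
  then have "(\<Sum>h. ?a h * (?w h - 1)) = (\<Sum>h<n. ?a h * ?w h) - (\<Sum>h. ?a h)"
    by (simp add: sums_iff algebra_simps)
  then show ?thesis
    unfolding expectation_avg_periodogram[OF assms(1,2)] spectral_density_0[OF sum]
      of_real_diff[symmetric]
    by (simp only: of_real_eq_iff) (simp add: field_simps)
qed

section \<open>Distance of the weights from 1\<close>

lemma one_minus_cos_le: "1 - cos x \<le> x\<^sup>2 / 2" for x :: real
proof -
  have "1 - cos x = 2 * (sin (x / 2))\<^sup>2"
    using cos_double_sin[of "x / 2"] by simp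
  also have "(sin (x / 2))\<^sup>2 \<le> (x / 2)\<^sup>2"
    using abs_sin_x_le_abs_x[of "x / 2"] by (simp only: abs_le_square_iff)
  finally show ?thesis
    by (simp add: power_divide)
qed

lemma abs_average_le:
  fixes f :: "nat \<Rightarrow> real"
  assumes "1 \<le> m" "\<And>j. j \<in> {1..m} \<Longrightarrow> \<bar>f j\<bar> \<le> c"
  shows "\<bar>1 / real m * (\<Sum>j=1..m. f j)\<bar> \<le> c"
proof -
  have "\<bar>\<Sum>j=1..m. f j\<bar> \<le> (\<Sum>j=1..m. c)"
    using assms(2) by (intro order_trans[OF sum_abs] sum_mono) 
  then show ?thesis
    using assms(1) by (simp add: abs_mult field_simps)
qed

text \<open>A bound uniform in \<open>n\<close> and \<open>h\<close>, which supplies the majorant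
  for dominated convergence when \<open>r = 0\<close>.\<close>

lemma abs_avg_weight_le_1:
  assumes "1 \<le> m"
  shows "\<bar>avg_weight m n h\<bar> \<le> 1"
proof -
  have "\<bar>1 / real m * (\<Sum>j=1..m. cos (real h * fourier_freq n j))\<bar> \<le> 1"
    by (rule abs_average_le[OF assms]) simp
  moreover have "\<bar>max 0 (1 - real h / real n)\<bar> \<le> 1"
    by simp
  ultimately show ?thesis
    unfolding avg_weight_def abs_mult[of "max _ _"] by (intro mult_le_one) auto
qed

text \<open>The first minimum is the loss from the triangular factor, the second the loss from the
  averaged cosine. As \<open>j \<le> m\<close>, each angle is at most
  \<open>2 * pi * m * h / n\<close>, and half its square gives the constant
  \<open>2 * pi\<^sup>2\<close>.\<close>

lemma avg_weight_dist_1: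
  assumes "1 \<le> m" "1 \<le> n"
  shows "\<bar>avg_weight m n h - 1\<bar> \<le>
     min 1 (real h / real n) + 2 * pi\<^sup>2 * min 1 ((real m * real h / real n)\<^sup>2)"
proof -
  let ?w = "max 0 (1 - real h / real n)" and ?x = "real m * real h / real n"
  define c where "c = 1 / real m * (\<Sum>j=1..m. cos (real h * fourier_freq n j))"
  have each: "\<bar>1 - cos (real h * fourier_freq n j)\<bar> \<le> 2 * pi\<^sup>2 * min 1 (?x\<^sup>2)" if "j \<in> {1..m}" for j
  proof -
    have "(real h * fourier_freq n j)\<^sup>2 \<le> (2 * pi * ?x)\<^sup>2"
    proof (rule power_mono)
      have "real j * real h / real n \<le> ?x"
        using that by (intro divide_right_mono mult_right_mono) auto
      then have "2 * pi * (real j * real h / real n) \<le> 2 * pi * ?x"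
        by (intro mult_left_mono) auto
      then show "real h * fourier_freq n j \<le> 2 * pi * ?x"
        by (simp add: fourier_freq_def mult_ac)
    qed (simp add: fourier_freq_def)
    then have "1 - cos (real h * fourier_freq n j) \<le> 2 * pi\<^sup>2 * ?x\<^sup>2"
      using one_minus_cos_le[of "real h * fourier_freq n j"]
      by (simp add: power_mult_distrib power_divide)
    \<comment> \<open>The trivial bound 2 is enlarged so that both branches of the minimum share one
      constant.\<close>
    moreover have "1 - cos (real h * fourier_freq n j) \<le> 2 * pi\<^sup>2 * 1"
    proof -
      have "1 \<le> pi\<^sup>2"
        using pi_gt3 by (intro one_le_power) linarith
      then show ?thesis
        using cos_ge_minus_one[of "real h * fourier_freq n j"] by linarith
    qed
    ultimately show ?thesis
      by (simp add: min_def)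
  qed
  have "1 / real m * (\<Sum>j=1..m. 1 - cos (real h * fourier_freq n j)) = 1 - c"
    using assms by (simp add: c_def sum_subtractf diff_divide_distrib)
  moreover have "\<bar>1 / real m * (\<Sum>j=1..m. 1 - cos (real h * fourier_freq n j))\<bar> \<le>
      2 * pi\<^sup>2 * min 1 (?x\<^sup>2)"
    by (rule abs_average_le[OF assms(1)]) (rule each)
  ultimately have c: "\<bar>1 - c\<bar> \<le> 2 * pi\<^sup>2 * min 1 (?x\<^sup>2)"
    by (simp only:)
  have c1: "\<bar>c\<bar> \<le> 1"
    unfolding c_def by (rule abs_average_le[OF assms(1)]) simp
  have w: "\<bar>?w - 1\<bar> = min 1 (real h / real n)"
    by (auto simp: max_def min_def)
  \<comment> \<open>Triangle inequality for
    \<open>?w * c - 1 = (?w - 1) * c - (1 - c)\<close>.\<close>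
  have "\<bar>?w * c - 1\<bar> \<le> \<bar>(?w - 1) * c\<bar> + \<bar>1 - c\<bar>"
    by (simp add: algebra_simps)
  also have "\<bar>(?w - 1) * c\<bar> \<le> \<bar>?w - 1\<bar>"
    using c1 by (simp add: abs_mult mult_left_le)
  finally show ?thesis
    using c unfolding w avg_weight_def c_def by linarith
qed

text \<open>The interpolation step: for \<open>x \<le> 1\<close> lowering the exponent enlarges the
  power, and for \<open>x > 1\<close> the right side is at least 1.\<close>

lemma min_1_powr_le:
  fixes x :: real
  assumes "0 \<le> s" "s \<le> p" "0 < x"
  shows "min 1 (x powr p) \<le> x powr s"
proof (cases "x \<le> 1")
  case True
  then have "x powr p \<le> x powr s"
    using assms by (auto intro: powr_mono')
  then show ?thesis
    by simp
next
  case False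
  then show ?thesis
    using assms by (simp add: ge_one_powr_ge_zero min.coboundedI1)
qed

text \<open>Both minima are at most \<open>(m * h / n) powr r\<close>. The first is interpolated
  from exponent 1, using \<open>h / n \<le> m * h / n\<close> and \<open>r \<le> 1\<close>, the
  second from exponent 2.\<close>

lemma avg_weight_dist_1_small:
  assumes "1 \<le> m" "1 \<le> n" "0 < r" "r \<le> 1" "1 \<le> h"
  shows "\<bar>avg_weight m n h - 1\<bar> \<le> (1 + 2 * pi\<^sup>2) * (real h powr r * (real m / real n) powr r)"
proof -
  let ?x = "real m * real h / real n"
  have x: "0 < ?x" and eq: "?x powr r = real h powr r * (real m / real n) powr r"
    using assms by (auto simp: powr_mult powr_divide)
  have "min 1 (real h / real n) \<le> min 1 (?x powr 1)"
    using assms by (intro min.mono) (auto simp: field_simps)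
  also have "\<dots> \<le> ?x powr r"
    using assms x by (intro min_1_powr_le) auto
  finally have a: "min 1 (real h / real n) \<le> ?x powr r" .
  have b: "min 1 (?x\<^sup>2) \<le> ?x powr r"
    using min_1_powr_le[of r 2 ?x] assms x by (simp add: powr_numeral)
  have "2 * pi\<^sup>2 * min 1 (?x\<^sup>2) \<le> 2 * pi\<^sup>2 * ?x powr r"
    using b by (intro mult_left_mono) auto
  then show ?thesis
    using avg_weight_dist_1[OF assms(1,2), of h] a unfolding eq[symmetric] by (simp only: distrib_right)
qed

text \<open>With \<open>r > 1\<close>, the triangular loss \<open>h / n\<close> is at most
  \<open>h powr r / n\<close>, the source of the rate \<open>1 / n\<close>. The cosine loss is
  quadratic, so its exponent is capped at 2; the remaining power of \<open>h\<close> is absorbed in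
  \<open>h powr r\<close>.\<close>

lemma avg_weight_dist_1_large:
  assumes "1 \<le> m" "1 \<le> n" "1 < r" "1 \<le> h"
  shows "\<bar>avg_weight m n h - 1\<bar> \<le> (1 + 2 * pi\<^sup>2) *
     (real h powr r * max (1 / real n) ((real m / real n) powr min 2 r))"
proof -
  let ?x = "real m * real h / real n" and ?s = "min 2 r"
  let ?M = "max (1 / real n) ((real m / real n) powr ?s)"
  have x: "0 < ?x" and eq: "?x powr ?s = real h powr ?s * (real m / real n) powr ?s"
    using assms by (auto simp: powr_mult powr_divide)
  have "real h powr 1 \<le> real h powr r"
    using assms by (intro powr_mono) auto
  then have "real h * (1 / real n) \<le> real h powr r * ?M"
    using assms by (intro mult_mono) auto
  then have a: "min 1 (real h / real n) \<le> real h powr r * ?M"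
    by simp
  have "min 1 (?x\<^sup>2) \<le> ?x powr ?s"
    using min_1_powr_le[of ?s 2 ?x] assms x by (simp add: powr_numeral)
  also have "\<dots> \<le> real h powr r * ?M"
    unfolding eq using assms by (intro mult_mono powr_mono) auto
  finally have "2 * pi\<^sup>2 * min 1 (?x\<^sup>2) \<le> 2 * pi\<^sup>2 * (real h powr r * ?M)"
    by (intro mult_left_mono) auto
  then show ?thesis
    using avg_weight_dist_1[OF assms(1,2), of h] a by (simp only: distrib_right)
qed

section \<open>Passing from the weights to the series\<close>

text \<open>The bound on the weights separates \<open>h\<close> from \<open>n\<close>, so
  \<open>B n\<close> factors out of the series and leaves the finite constant
  \<open>\<Sum>h. v h * \<bar>a h\<bar>\<close>.\<close>

lemma weighted_suminf_bigo:
  fixes a :: "nat \<Rightarrow> real" and B :: "nat \<Rightarrow> real" and b :: "nat \<Rightarrow> complex"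
  assumes "summable (\<lambda>h. v h * \<bar>a h\<bar>)" and "\<And>n. 1 \<le> n \<Longrightarrow> 0 \<le> B n"
    and w: "\<And>n h. 1 \<le> n \<Longrightarrow> \<bar>w n h - 1\<bar> \<le> C * (v h * B n)"
    and b: "\<And>n. 1 \<le> n \<Longrightarrow> b n = complex_of_real (c * (\<Sum>h. a h * (w n h - 1)))"
  shows "b \<in> O(\<lambda>n. of_real (B n))"
proof (rule bigoI[of _ "\<bar>c\<bar> * (C * (\<Sum>h. v h * \<bar>a h\<bar>))"], unfold eventually_sequentially, intro exI allI impI)
  fix n :: nat assume n: "1 \<le> n"
  let ?S = "\<Sum>h. a h * (w n h - 1)"
  have sums: "summable (\<lambda>h. C * B n * (v h * \<bar>a h\<bar>))"
    using assms(1) by (rule summable_mult)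
  have "norm ?S \<le> (\<Sum>h. C * B n * (v h * \<bar>a h\<bar>))"
  proof (rule norm_suminf_le[OF _ sums])
    show "norm (a h * (w n h - 1)) \<le> C * B n * (v h * \<bar>a h\<bar>)" for h
      using mult_left_mono[OF w[OF n, of h], of "\<bar>a h\<bar>"] by (simp add: abs_mult mult_ac)
  qed
  also have "\<dots> = C * (\<Sum>h. v h * \<bar>a h\<bar>) * B n"
    using assms(1) by (simp add: suminf_mult)
  finally have "\<bar>c\<bar> * \<bar>?S\<bar> \<le> \<bar>c\<bar> * (C * (\<Sum>h. v h * \<bar>a h\<bar>) * B n)"
    by (intro mult_left_mono) auto
  then show "norm (b n) \<le> \<bar>c\<bar> * (C * (\<Sum>h. v h * \<bar>a h\<bar>)) * norm (complex_of_real (B n))"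
    using assms(2)[OF n] by (simp add: b[OF n] norm_mult abs_mult mult_ac flip: of_real_mult)
qed

text \<open>At a fixed lag both losses vanish in the limit, since \<open>h / n\<close> and
  \<open>m / n\<close> tend to 0. This is the pointwise convergence for the case
  \<open>r = 0\<close>.\<close>

lemma avg_weight_tendsto_1:
  assumes "\<And>n. 1 \<le> n \<Longrightarrow> 1 \<le> m n" and "(\<lambda>n. real (m n)) \<in> o(\<lambda>n. real n)"
  shows "(\<lambda>n. avg_weight (m n) n h) \<longlonglongrightarrow> 1"
proof -
  have mn: "(\<lambda>n. real (m n) / real n) \<longlonglongrightarrow> 0"
    using assms(2) by (rule smalloD_tendsto)
  have "(\<lambda>n. avg_weight (m n) n h - 1) \<longlonglongrightarrow> 0"
  proof (rule Lim_null_comparison)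
    show "\<forall>\<^sub>F n in sequentially. norm (avg_weight (m n) n h - 1) \<le>
        real h / real n + 2 * pi\<^sup>2 * (real (m n) / real n * real h)\<^sup>2"
    proof (rule eventually_sequentiallyI)
      fix n :: nat assume n: "1 \<le> n"
      have "2 * pi\<^sup>2 * min 1 ((real (m n) * real h / real n)\<^sup>2) \<le>
          2 * pi\<^sup>2 * (real (m n) / real n * real h)\<^sup>2"
        by (intro mult_left_mono) auto
      then show "norm (avg_weight (m n) n h - 1) \<le>
          real h / real n + 2 * pi\<^sup>2 * (real (m n) / real n * real h)\<^sup>2"
        using avg_weight_dist_1[OF assms(1)[OF n] n, of h] min.cobounded2[of 1 "real h / real n"]
        unfolding real_norm_def by linarith
    qed
    show "(\<lambda>n. real h / real n + 2 * pi\<^sup>2 * (real (m n) / real n * real h)\<^sup>2) \<longlonglongrightarrow> 0"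
      by (rule tendsto_eq_intros mn lim_const_over_n refl | simp)+
  qed
  then show ?thesis
    using Lim_null by blast
qed

theorem theorem3:
  fixes M :: "'a measure" and X :: "int \<Rightarrow> 'a \<Rightarrow> real"
    and r :: real and m :: "nat \<Rightarrow> nat"
  assumes "prob_space M"
    and "strictly_stationary M X"
    and "integrable M (\<lambda>x. (X 0 x)\<^sup>2)"
    and "(\<integral>x. X 0 x \<partial>M) = 0"
    and "r \<ge> 0"
    and "summable (\<lambda>h. real (Suc h) powr r * \<bar>autocov M X (int (Suc h))\<bar>)"
    and "\<And>n. n \<ge> 1 \<Longrightarrow> m n \<ge> 1"
    and "filterlim m at_top sequentially"
    and "(\<lambda>n. real (m n)) \<in> o(\<lambda>n. real n)"
  defines "bias \<equiv> \<lambda>n. complex_of_real (\<integral>x. avg_periodogram X (m n) n x \<partial>M)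
                      - spectral_density M X 0"
  shows "(r = 0 \<longrightarrow> bias \<in> o(\<lambda>n. 1)) \<and>
         (0 < r \<and> r \<le> 1 \<longrightarrow>
            bias \<in> O(\<lambda>n. of_real ((real (m n) / real n) powr r))) \<and>
         (r > 1 \<longrightarrow>
            bias \<in> O(\<lambda>n. of_real (max (1 / real n) ((real (m n) / real n) powr (min 2 r)))))"
proof -
  interpret prob_space M by fact
  interpret centred_stationary M X
    by unfold_locales fact+
  define a where "a = (\<lambda>h. autocov M X (int (Suc h)))"
  define w where "w = (\<lambda>n h. avg_weight (m n) n (Suc h))"
  have sum: "summable (\<lambda>h. real (Suc h) powr r * \<bar>a h\<bar>)"
    using assms(6) by (simp add: a_def)
  \<comment> \<open>The factor \<open>Suc h powr r\<close> is at least 1, so the weighted hypothesis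
    implies absolute summability, as the formula for the bias requires.\<close>
  have sum0: "summable (\<lambda>h. \<bar>a h\<bar>)"
  proof (rule summable_comparison_test'[OF sum])
    fix h
    have "1 \<le> real (Suc h) powr r"
      using \<open>r \<ge> 0\<close> by (intro ge_one_powr_ge_zero) auto
    then show "norm \<bar>a h\<bar> \<le> real (Suc h) powr r * \<bar>a h\<bar>"
      using mult_right_mono[of 1 _ "\<bar>a h\<bar>"] by simp
  qed
  have bias: "bias n = complex_of_real (1 / pi * (\<Sum>h. a h * (w n h - 1)))" if "1 \<le> n" for n
    using bias_eq[OF that assms(7)[OF that]] sum0 by (simp add: bias_def a_def w_def)
  show ?thesis
  proof (intro conjI impI)
    \<comment> \<open>Tannery's theorem, that is, dominated convergence for series, with the
      majorant \<open>2 * \<bar>a h\<bar>\<close>.\<close>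
    have "(\<lambda>n. \<Sum>h. a h * (w n h - 1)) \<longlonglongrightarrow> (\<Sum>h. 0)"
    proof (rule tannerys_theorem[THEN conjunct2, THEN conjunct2])
      show "(\<lambda>n. a h * (w n h - 1)) \<longlonglongrightarrow> 0" for h
        unfolding w_def
        by (rule tendsto_eq_intros avg_weight_tendsto_1[OF assms(7,9)] refl | simp)+
      have "norm (a h * (w n h - 1)) \<le> 2 * \<bar>a h\<bar>" if "1 \<le> n" for h n
        using abs_avg_weight_le_1[OF assms(7)[OF that], of n "Suc h"]
          mult_left_mono[of "\<bar>w n h - 1\<bar>" 2 "\<bar>a h\<bar>"]
        by (simp add: w_def abs_mult abs_le_iff mult.commute)
      \<comment> \<open>The domination holds for every \<open>h\<close> once
        \<open>n \<ge> 1\<close>, so only the second filter restricts anything.\<close>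
      then show "\<forall>\<^sub>F (h, n) in at_top \<times>\<^sub>F sequentially. norm (a h * (w n h - 1)) \<le> 2 * \<bar>a h\<bar>"
        unfolding eventually_prod_filter
        by (intro exI[of _ "\<lambda>_. True"] exI[of _ "\<lambda>n. 1 \<le> n"])
           (auto simp: eventually_sequentially)
      show "summable (\<lambda>h. 2 * \<bar>a h\<bar>)"
        using sum0 by (rule summable_mult)
    qed simp
    then have "(\<lambda>n. complex_of_real (1 / pi * (\<Sum>h. a h * (w n h - 1)))) \<longlonglongrightarrow> complex_of_real (1 / pi * 0)"
      by (intro tendsto_of_real tendsto_mult_left) simp
    moreover have "\<forall>\<^sub>F n in sequentially. complex_of_real (1 / pi * (\<Sum>h. a h * (w n h - 1))) = bias n"
      using bias by (intro eventually_sequentiallyI[of 1]) simp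
    ultimately have "bias \<longlonglongrightarrow> 0"
      using Lim_transform_eventually by fastforce
    then show "bias \<in> o(\<lambda>n. 1)"
      by (intro smalloI_tendsto) simp_all
  next
    assume r: "0 < r \<and> r \<le> 1"
    show "bias \<in> O(\<lambda>n. of_real ((real (m n) / real n) powr r))"
    \<comment> \<open>Here \<open>v h\<close> is \<open>Suc h powr r\<close>, so the constant is
      finite by the hypothesis on the autocovariances, and \<open>B n\<close> is the claimed
      rate.\<close>
    proof (rule weighted_suminf_bigo[OF sum _ _ bias])
      show "\<bar>w n h - 1\<bar> \<le> (1 + 2 * pi\<^sup>2) * (real (Suc h) powr r * (real (m n) / real n) powr r)"
        if "1 \<le> n" for n h
        unfolding w_def using r that by (intro avg_weight_dist_1_small assms(7)) auto
    qed auto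
  next
    assume r: "r > 1"
    show "bias \<in> O(\<lambda>n. of_real (max (1 / real n) ((real (m n) / real n) powr (min 2 r))))"
    proof (rule weighted_suminf_bigo[OF sum _ _ bias])
      show "\<bar>w n h - 1\<bar> \<le> (1 + 2 * pi\<^sup>2) *
          (real (Suc h) powr r * max (1 / real n) ((real (m n) / real n) powr (min 2 r)))"
        if "1 \<le> n" for n h
        unfolding w_def using r that by (intro avg_weight_dist_1_large assms(7)) auto
    qed (auto simp: le_max_iff_disj)
  qed
qed

end
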